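(* Let $H\subset\mathrm{PGL}_n\mathbb R$ be a symmetric subgroup, let $X\in\mathfrak b$, and let $L=Z_H(X)\ltimes N_+(X)$ be the corresponding limit $\lim_{t\to\infty}\exp(tX)H\exp(-tX)$ of $H$. Let $E_0,\ldots,E_k$ be the eigenspaces of $X$ listed in order of increasing eigenvalue, and let $\mathcal F=\mathcal F(X)$ be the partial flag $V_0\supset V_1\supset\cdots\supset V_k\supset V_{k+1}=\{0\}$ with $V_j=E_j\oplus\cdots\oplus E_k$. Then $L\subset\mathrm{PGL}(\mathcal F)$. Further, the group $Z_H(X)$ consists of all elements of $H$ which preserve the decomposition $\mathbb R^n=E_0\oplus\cdots\oplus E_k$, while $N_+(X)=U(\mathcal F)$. So, in a basis respecting the decomposition $\mathbb R^n=E_0\oplus\cdots\oplus E_k$, every element of $L$ has the form $$\begin{pmatrix}A_0&0&0&\cdots&0\\ *&A_1&0&\cdots&0\\ *&*&A_2&\cdots&0\\ \cdots&\cdots&\cdots&\cdots&\cdots\\ *&*&*&\cdots&A_k\end{pmatrix}$$ where $\mathrm{diag}(A_0,\ldots,A_k)\in H\cap\mathrm P(\mathrm{GL}(E_0)\oplus\cdots\oplus\mathrm{GL}(E_k))$ and each $*$ denotes a block which may take arbitrary values.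
   Context: $H$ is a symmetric subgroup of $G=\mathrm{PGL}_n\mathbb R$: there is a continuous automorphism $\sigma$ of $G$ with $\sigma^2=1$ such that $G^\sigma_0\subset H\subset G^\sigma$, where $G^\sigma$ is the fixed point group and $G^\sigma_0$ its identity component. Coordinates are chosen so that the standard Cartan involution $\theta(g)=g^{-T}$ commutes with $\sigma$. Identify $\mathfrak g$ with trace-less $n\times n$ matrices, let $\mathfrak q$ be the $-1$ eigenspace of $\sigma$ and $\mathfrak p$ the $-1$ eigenspace of $\theta$ (symmetric matrices) on $\mathfrak g$. Coordinates are further chosen so that $\mathfrak b$, a maximal abelian subalgebra of $\mathfrak p\cap\mathfrak q$, is a subspace of the trace-less real diagonal matrices. $\mathrm P$ denotes the projection from general linear to projective general linear groups. $Z_H(X)=\{h\in H:\mathrm{Ad}(h)X=X\}$ and $N_+(X)=\{g\in G:\lim_{t\to\infty}\exp(tX)^{-1}g\exp(tX)=1\}$. The limit of the groups $\exp(tX)H\exp(-tX)$ is in the Chabauty topology on closed subgroups. It equals $Z_H(X)\ltimes N_+(X)$, and every limit of $H$ under a sequence of conjugations is conjugate to one of this form for some $X\in\mathfrak b$. $\mathrm{PGL}(\mathcal F)$ is the subgroup of $\mathrm{PGL}_n\mathbb R$ which stabilizes the flag $\mathcal F$; there is a natural surjection $\pi_{\mathcal F}:\mathrm{PGL}(\mathcal F)\to\mathrm P\big(\bigoplus_{i=0}^k\mathrm{GL}(V_i/V_{i+1})\big)$, and the flag unipotent subgroup is $U(\mathcal F)=\ker(\pi_{\mathcal F})$. *)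

theory Defs
  imports "HOL-Analysis.Analysis" "HOL-Algebra.Bij" "HOL-Algebra.Product_Groups"
begin

section \<open>The projective general linear group\<close>

definition GL :: "(real^'n^'n) monoid" where
  "GL = \<lparr>carrier = {A. invertible A}, mult = (**), one = mat 1\<rparr>"

definition scalar_matrices :: "(real^'n^'n) set" where
  "scalar_matrices = {c *\<^sub>R mat 1 | c. c \<noteq> 0}"

definition PGL :: "(real^'n^'n) set monoid" where
  "PGL = GL Mod scalar_matrices"

text \<open>For invertible \<open>A\<close> this is the class of \<open>A\<close> in \<open>PGL\<close>; for singular \<open>A\<close> the set
  \<open>{c A | c \<noteq> 0}\<close> does not belong to \<open>carrier PGL\<close>.\<close>

definition proj :: "real^'n^'n \<Rightarrow> (real^'n^'n) set" where
  "proj A = scalar_matrices #>\<^bsub>GL\<^esub> A"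

text \<open>The quotient topology: a set of classes is open iff its preimage in \<open>GL\<close> is open.\<close>

definition PGL_topology :: "(real^'n^'n) set topology" where
  "PGL_topology = topology (\<lambda>U. U \<subseteq> carrier PGL \<and>
     openin (top_of_set (carrier GL)) {A \<in> carrier GL. proj A \<in> U})"

lemma openin_PGL_topology:
  fixes U :: "(real^'n^'n) set set"
  shows
  "openin PGL_topology U \<longleftrightarrow> U \<subseteq> carrier PGL \<and>
     openin (top_of_set (carrier GL)) {A \<in> carrier GL. proj A \<in> U}"
proof -
  have "istopology (\<lambda>U :: (real^'n^'n) set set. U \<subseteq> carrier PGL \<and>
     openin (top_of_set (carrier GL)) {A \<in> carrier GL. proj A \<in> U})" (is "istopology ?P")
    unfolding istopology_def
  proof (intro conjI allI impI)
    fix S T assume "?P S" "?P T"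
    moreover have "{A \<in> carrier GL. proj A \<in> S \<inter> T} =
        {A \<in> carrier GL. proj A \<in> S} \<inter> {A \<in> carrier GL. proj A \<in> T}" by auto
    ultimately show "S \<inter> T \<subseteq> carrier PGL"
      "openin (top_of_set (carrier GL)) {A \<in> carrier GL. proj A \<in> S \<inter> T}"
      by (auto simp del: Int_iff)
  next
    fix \<K> assume K: "\<forall>K\<in>\<K>. ?P K"
    then show "\<Union>\<K> \<subseteq> carrier PGL" by blast
    have "{A \<in> carrier GL. proj A \<in> \<Union>\<K>} = (\<Union>K\<in>\<K>. {A \<in> carrier GL. proj A \<in> K})" by auto
    with K show "openin (top_of_set (carrier GL)) {A \<in> carrier GL. proj A \<in> \<Union>\<K>}"
      by (simp only:) (blast intro: openin_Union)
  qed
  then show ?thesis by (simp add: PGL_topology_def topology_inverse')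
qed

section \<open>Lie algebra and symmetric subgroups\<close>

definition matrix_exp :: "real^'n^'n \<Rightarrow> real^'n^'n" where
  "matrix_exp X = (\<Sum>m. (1 / fact m) *\<^sub>R (((**) X) ^^ m) (mat 1))"

definition traceless :: "(real^'n^'n) set" where
  "traceless = {X. trace X = 0}"

text \<open>\<open>has_lie_differential \<tau> X Y\<close> says that the differential of the automorphism \<open>\<tau>\<close> of \<open>PGL\<close>
  maps \<open>X\<close> to \<open>Y\<close>: for traceless \<open>X\<close> it is the unique traceless \<open>Y\<close> with this property.\<close>

definition has_lie_differential ::
    "((real^'n^'n) set \<Rightarrow> (real^'n^'n) set) \<Rightarrow> real^'n^'n \<Rightarrow> real^'n^'n \<Rightarrow> bool" where
  "has_lie_differential \<tau> X Y \<longleftrightarrow> X \<in> traceless \<and> Y \<in> traceless \<and>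
     (\<forall>t::real. \<tau> (proj (matrix_exp (t *\<^sub>R X))) = proj (matrix_exp (t *\<^sub>R Y)))"

definition minus_eigenspace ::
    "((real^'n^'n) set \<Rightarrow> (real^'n^'n) set) \<Rightarrow> (real^'n^'n) set" where
  "minus_eigenspace \<tau> = {X \<in> traceless. has_lie_differential \<tau> X (- X)}"

definition cartan_involution :: "(real^'n^'n) set \<Rightarrow> (real^'n^'n) set" where
  "cartan_involution g = (\<lambda>A. transpose (matrix_inv A)) ` g"

definition fixed_points ::
    "((real^'n^'n) set \<Rightarrow> (real^'n^'n) set) \<Rightarrow> (real^'n^'n) set set" where
  "fixed_points \<sigma> = {g \<in> carrier PGL. \<sigma> g = g}"

definition continuous_involution :: "((real^'n^'n) set \<Rightarrow> (real^'n^'n) set) \<Rightarrow> bool" where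
  "continuous_involution \<sigma> \<longleftrightarrow> \<sigma> \<in> iso PGL PGL \<and> continuous_map PGL_topology PGL_topology \<sigma> \<and>
     (\<forall>g\<in>carrier PGL. \<sigma> (\<sigma> g) = g)"

definition symmetric_subgroup ::
    "((real^'n^'n) set \<Rightarrow> (real^'n^'n) set) \<Rightarrow> (real^'n^'n) set set \<Rightarrow> bool" where
  "symmetric_subgroup \<sigma> H \<longleftrightarrow> continuous_involution \<sigma> \<and> subgroup H PGL \<and>
     connected_component_of_set (subtopology PGL_topology (fixed_points \<sigma>)) \<one>\<^bsub>PGL\<^esub> \<subseteq> H \<and>
     H \<subseteq> fixed_points \<sigma>"

definition abelian_subalgebra :: "(real^'n^'n) set \<Rightarrow> bool" where
  "abelian_subalgebra \<bb> \<longleftrightarrow> subspace \<bb> \<and> \<bb> \<subseteq> traceless \<and>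
     (\<forall>X\<in>\<bb>. \<forall>Y\<in>\<bb>. X ** Y - Y ** X = 0)"

text \<open>The ambient set \<open>S\<close> need not itself be a subalgebra: maximality is among the abelian
  subalgebras contained in \<open>S\<close>.\<close>

definition maximal_abelian_subalgebra_of :: "(real^'n^'n) set \<Rightarrow> (real^'n^'n) set \<Rightarrow> bool" where
  "maximal_abelian_subalgebra_of S \<bb> \<longleftrightarrow> abelian_subalgebra \<bb> \<and> \<bb> \<subseteq> S \<and>
     (\<forall>\<cc>. abelian_subalgebra \<cc> \<and> \<cc> \<subseteq> S \<and> \<bb> \<subseteq> \<cc> \<longrightarrow> \<cc> = \<bb>)"

definition diagonal_matrices :: "(real^'n^'n) set" where
  "diagonal_matrices = {D. \<forall>i j. i \<noteq> j \<longrightarrow> D $ i $ j = 0}"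

section \<open>Conjugacy limits\<close>

text \<open>The conjugate by any representative is the same, since representatives differ by scalars.\<close>

definition Ad :: "(real^'n^'n) set \<Rightarrow> real^'n^'n \<Rightarrow> real^'n^'n" where
  "Ad g X = (THE Y. \<forall>A\<in>g. A ** X ** matrix_inv A = Y)"

definition centralizer_in :: "(real^'n^'n) set set \<Rightarrow> real^'n^'n \<Rightarrow> (real^'n^'n) set set" where
  "centralizer_in H X = {h \<in> H. Ad h X = X}"

definition one_param :: "real^'n^'n \<Rightarrow> real \<Rightarrow> (real^'n^'n) set" where
  "one_param X t = proj (matrix_exp (t *\<^sub>R X))"

definition N_plus :: "real^'n^'n \<Rightarrow> (real^'n^'n) set set" where
  "N_plus X = {g \<in> carrier PGL.
     limitin PGL_topology
       (\<lambda>t. inv\<^bsub>PGL\<^esub> (one_param X t) \<otimes>\<^bsub>PGL\<^esub> g \<otimes>\<^bsub>PGL\<^esub> one_param X t) \<one>\<^bsub>PGL\<^esub> at_top}"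

definition conjugate_subgroup :: "real^'n^'n \<Rightarrow> (real^'n^'n) set set \<Rightarrow> real \<Rightarrow> (real^'n^'n) set set"
  where "conjugate_subgroup X H t =
     (\<lambda>h. one_param X t \<otimes>\<^bsub>PGL\<^esub> h \<otimes>\<^bsub>PGL\<^esub> inv\<^bsub>PGL\<^esub> (one_param X t)) ` H"

text \<open>The Chabauty topology on closed subgroups: the subbasic open sets are the subgroups missing
  a given compact set, and the subgroups meeting a given open set.\<close>

definition chabauty_topology :: "('a, 'b) monoid_scheme \<Rightarrow> 'a topology \<Rightarrow> 'a set topology" where
  "chabauty_topology G T = subtopology
     (topology_generated_by
        ({{C. closedin T C \<and> C \<inter> K = {}} | K. compactin T K} \<union>
         {{C. closedin T C \<and> C \<inter> U \<noteq> {}} | U. openin T U}))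
     {C. subgroup C G}"

section \<open>Eigenspaces and flags\<close>

definition eigenvalues :: "real^'n^'n \<Rightarrow> real set" where
  "eigenvalues X = {c. \<exists>v. v \<noteq> 0 \<and> X *v v = c *\<^sub>R v}"

definition eigenspace :: "real^'n^'n \<Rightarrow> real \<Rightarrow> (real^'n) set" where
  "eigenspace X c = {v. X *v v = c *\<^sub>R v}"

text \<open>A flag \<open>V 0 \<supset> \<dots> \<supset> V k \<supset> V (k + 1) = {0}\<close> is given by the function \<open>V\<close> and the number \<open>k\<close>.\<close>

definition PGL_flag :: "nat \<Rightarrow> (nat \<Rightarrow> (real^'n) set) \<Rightarrow> (real^'n^'n) set set" where
  "PGL_flag k V = {g \<in> carrier PGL. \<forall>A\<in>g. \<forall>i\<le>k + 1. (*v) A ` V i = V i}"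

definition quotient_space :: "(real^'n) set \<Rightarrow> (real^'n) set \<Rightarrow> (real^'n) set set" where
  "quotient_space V W = (\<lambda>v. (+) v ` W) ` V"

definition coset_add :: "(real^'n) set \<Rightarrow> (real^'n) set \<Rightarrow> (real^'n) set" where
  "coset_add C D = {x + y | x y. x \<in> C \<and> y \<in> D}"

text \<open>Adding \<open>W\<close> matters only for \<open>c = 0\<close>, where the result has to be the zero coset \<open>W\<close>.\<close>

definition coset_scale :: "(real^'n) set \<Rightarrow> real \<Rightarrow> (real^'n) set \<Rightarrow> (real^'n) set" where
  "coset_scale W c C = {c *\<^sub>R x + w | x w. x \<in> C \<and> w \<in> W}"

definition GL_quotient ::
    "(real^'n) set \<Rightarrow> (real^'n) set \<Rightarrow> ((real^'n) set \<Rightarrow> (real^'n) set) monoid" where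
  "GL_quotient V W = (BijGroup (quotient_space V W))
     \<lparr>carrier := {f \<in> Bij (quotient_space V W).
        (\<forall>C\<in>quotient_space V W. \<forall>D\<in>quotient_space V W.
           f (coset_add C D) = coset_add (f C) (f D)) \<and>
        (\<forall>c. \<forall>C\<in>quotient_space V W. f (coset_scale W c C) = coset_scale W c (f C))}\<rparr>"

definition graded_GL ::
    "nat \<Rightarrow> (nat \<Rightarrow> (real^'n) set) \<Rightarrow> (nat \<Rightarrow> (real^'n) set \<Rightarrow> (real^'n) set) monoid" where
  "graded_GL k V = product_group {..k} (\<lambda>i. GL_quotient (V i) (V (Suc i)))"

definition graded_scalars ::
    "nat \<Rightarrow> (nat \<Rightarrow> (real^'n) set) \<Rightarrow> (nat \<Rightarrow> (real^'n) set \<Rightarrow> (real^'n) set) set" where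
  "graded_scalars k V =
     {(\<lambda>i\<in>{..k}. \<lambda>C\<in>quotient_space (V i) (V (Suc i)). coset_scale (V (Suc i)) c C) | c. c \<noteq> 0}"

definition graded_PGL ::
    "nat \<Rightarrow> (nat \<Rightarrow> (real^'n) set) \<Rightarrow> (nat \<Rightarrow> (real^'n) set \<Rightarrow> (real^'n) set) set monoid" where
  "graded_PGL k V = graded_GL k V Mod graded_scalars k V"

definition graded_map ::
    "nat \<Rightarrow> (nat \<Rightarrow> (real^'n) set) \<Rightarrow> real^'n^'n \<Rightarrow> nat \<Rightarrow> (real^'n) set \<Rightarrow> (real^'n) set" where
  "graded_map k V A = (\<lambda>i\<in>{..k}. \<lambda>C\<in>quotient_space (V i) (V (Suc i)). (*v) A ` C)"

text \<open>The image of the class \<open>{c A | c \<noteq> 0}\<close> is the class of \<open>graded_map k V A\<close> modulo scalars.\<close>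

definition flag_projection ::
    "nat \<Rightarrow> (nat \<Rightarrow> (real^'n) set) \<Rightarrow> (real^'n^'n) set
       \<Rightarrow> (nat \<Rightarrow> (real^'n) set \<Rightarrow> (real^'n) set) set" where
  "flag_projection k V g = graded_map k V ` g"

definition flag_unipotent :: "nat \<Rightarrow> (nat \<Rightarrow> (real^'n) set) \<Rightarrow> (real^'n^'n) set set" where
  "flag_unipotent k V =
     kernel (PGL\<lparr>carrier := PGL_flag k V\<rparr>) (graded_PGL k V) (flag_projection k V)"

text \<open>The group \<open>P(GL(E 0) \<oplus> \<dots> \<oplus> GL(E k))\<close>; each summand is preserved, so no permutations.\<close>

definition P_GL_sum :: "nat \<Rightarrow> (nat \<Rightarrow> (real^'n) set) \<Rightarrow> (real^'n^'n) set set" where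
  "P_GL_sum k E = {g \<in> carrier PGL. \<forall>A\<in>g. \<forall>i\<le>k. (*v) A ` E i = E i}"

section \<open>Block matrices\<close>

text \<open>A basis of \<open>\<real>\<^sup>n\<close> is encoded as an invertible matrix, its vectors being the columns;
  \<open>blk j\<close> is the index of the summand containing the \<open>j\<close>-th one.\<close>

definition basis_respecting ::
    "nat \<Rightarrow> (nat \<Rightarrow> (real^'n) set) \<Rightarrow> real^'n^'n \<Rightarrow> ('n \<Rightarrow> nat) \<Rightarrow> bool" where
  "basis_respecting k E B blk \<longleftrightarrow> invertible B \<and> (\<forall>j. blk j \<le> k \<and> column j B \<in> E (blk j))"

text \<open>The operator whose matrix in the basis \<open>B\<close> is \<open>T\<close>.\<close>

definition in_basis :: "real^'n^'n \<Rightarrow> real^'n^'n \<Rightarrow> real^'n^'n" where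
  "in_basis B T = B ** T ** matrix_inv B"

text \<open>Entry \<open>(i, j)\<close> lies in block row \<open>blk i\<close> and block column \<open>blk j\<close>.\<close>

definition block_lower_triangular :: "('n \<Rightarrow> nat) \<Rightarrow> real^'n^'n \<Rightarrow> bool" where
  "block_lower_triangular blk T \<longleftrightarrow> (\<forall>i j. blk i < blk j \<longrightarrow> T $ i $ j = 0)"

definition block_diagonal_part :: "('n \<Rightarrow> nat) \<Rightarrow> real^'n^'n \<Rightarrow> real^'n^'n" where
  "block_diagonal_part blk T = (\<chi> i j. if blk i = blk j then T $ i $ j else 0)"

end

theory Submission
  imports Defs "HOL-Real_Asymp.Real_Asymp"
begin

text \<open>Since \<open>X\<close> is diagonal with entries \<open>d i\<close>, number its eigenvalues increasingly and let \<open>b i\<close> be the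
  number of the eigenvalue \<open>d i\<close>. The eigenspaces of \<open>X\<close> are then the coordinate subspaces
  \<open>block_space b j\<close>, the flag consists of the coordinate subspaces \<open>flag_space b j\<close>, and each group in
  question is described by conditions on single matrix entries.

  A class of matrices centralizes \<open>X\<close> iff its representatives commute with \<open>X\<close>, that is, iff they are
  block diagonal; equivalently, they preserve every eigenspace. Conjugation by \<open>exp(- t X)\<close>
  multiplies the entry \<open>(i, j)\<close> by \<open>exp (t (d j - d i))\<close>, so in the limit the entries strictly below
  the block diagonal are contracted to \<open>0\<close>, those in diagonal blocks stay and the others explode. Hence
  \<open>N_plus X\<close> consists of the classes of block lower triangular matrices with identity diagonal blocks
  (\<open>N_plus_diag\<close>). The point that needs care is that convergence takes place in the projective group,
  where only functions that are homogeneous of degree \<open>0\<close> can be tested; this is the content of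
  \<open>limitin_proj_one\<close>. The same matrices are those that act on each quotient of the flag by one
  common scalar, which identifies \<open>N_plus X\<close> with the flag unipotent subgroup
  (\<open>flag_unipotent_eq\<close>).

  A block lower triangular matrix with invertible diagonal part \<open>A\<close> is uniquely \<open>A\<close> times such a
  unipotent matrix. This gives the block form of \<open>L\<close> in the standard basis
  (\<open>block_diagonal_times_unipotent\<close>). The passage to another basis \<open>B\<close> respecting the
  decomposition is harmless, because \<open>B\<close> only has entries between indices of the same eigenvalue, and so
  conjugation by \<open>B\<close> never mixes blocks (\<open>in_basis_block_entry\<close>).\<close>

section \<open>Diagonal and block matrices\<close>

definition diag_matrix :: "('n \<Rightarrow> real) \<Rightarrow> real^'n^'n" where
  "diag_matrix d = (\<chi> i j. if i = j then d i else 0)"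

definition block_diagonal :: "('n \<Rightarrow> nat) \<Rightarrow> real^'n^'n \<Rightarrow> bool" where
  "block_diagonal b A \<longleftrightarrow> (\<forall>i j. b i \<noteq> b j \<longrightarrow> A $ i $ j = 0)"

text \<open>One condition covers the diagonal blocks, where the identity is prescribed, and the blocks above
  the diagonal, where \<open>b i < b j\<close> forces \<open>i \<noteq> j\<close>.\<close>

definition block_unipotent :: "('n \<Rightarrow> nat) \<Rightarrow> real^'n^'n \<Rightarrow> bool" where
  "block_unipotent b N \<longleftrightarrow> (\<forall>i j. b i \<le> b j \<longrightarrow> N $ i $ j = (if i = j then 1 else 0))"

definition block_space :: "('n \<Rightarrow> nat) \<Rightarrow> nat \<Rightarrow> (real^'n) set" where
  "block_space b j = {v. \<forall>i. b i \<noteq> j \<longrightarrow> v $ i = 0}"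

definition flag_space :: "('n \<Rightarrow> nat) \<Rightarrow> nat \<Rightarrow> (real^'n) set" where
  "flag_space b j = {v. \<forall>i. b i < j \<longrightarrow> v $ i = 0}"

lemma diag_matrix_nth [simp]: "diag_matrix d $ i $ j = (if i = j then d i else 0)"
  by (simp add: diag_matrix_def)

lemma mat_one_nth: "mat 1 $ i $ j = (if i = j then 1 else 0)"
  by (simp add: mat_def)

lemma matrix_mult_nth: "(A ** B) $ i $ j = (\<Sum>p\<in>UNIV. A $ i $ p * B $ p $ j)"
  for A :: "real^'n^'m" and B :: "real^'k^'n"
  by (simp add: matrix_matrix_mult_def)

lemma matrix_vector_nth: "(A *v v) $ i = (\<Sum>p\<in>UNIV. A $ i $ p * v $ p)"
  for A :: "real^'n^'n"
  by (simp add: matrix_vector_mult_def)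

lemma matrix_mult_diag_nth: "(A ** diag_matrix d) $ i $ j = A $ i $ j * d j"
  by (simp add: matrix_mult_nth if_distrib[of "(*) _"] cong: if_cong)

lemma diag_mult_matrix_nth: "(diag_matrix d ** A) $ i $ j = d i * A $ i $ j"
  by (simp add: matrix_mult_nth if_distrib[of "\<lambda>x. x * _"] cong: if_cong)

lemma diag_matrix_mult: "diag_matrix d ** diag_matrix e = diag_matrix (\<lambda>i. d i * e i)"
  by (simp add: vec_eq_iff matrix_mult_diag_nth)

lemma diag_matrix_one: "diag_matrix (\<lambda>_. 1) = mat 1"
  by (simp add: vec_eq_iff mat_def)

lemma matrix_inv_cancel:
  fixes A :: "real^'n^'n"
  assumes "invertible A"
  shows "A ** matrix_inv A = mat 1" "matrix_inv A ** A = mat 1"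
  using someI_ex[OF assms[unfolded invertible_def]] by (simp_all add: matrix_inv_def)

lemma matrix_inv_unique:
  fixes A B :: "real^'n^'n"
  assumes "A ** B = mat 1"
  shows "invertible A" "matrix_inv A = B"
proof -
  show "invertible A" using assms invertible_right_inverse by blast
  then show "matrix_inv A = B"
    by (metis assms matrix_inv_cancel(2) matrix_mul_assoc matrix_mul_lid matrix_mul_rid)
qed

lemma invertible_one: "invertible (mat 1 :: real^'n^'n)"
  by (rule matrix_inv_unique(1)[of _ "mat 1"]) simp

lemma matrix_inv_diag:
  assumes "\<And>i. d i \<noteq> 0"
  shows "matrix_inv (diag_matrix d) = diag_matrix (\<lambda>i. inverse (d i))"
  by (rule matrix_inv_unique) (simp add: diag_matrix_mult assms diag_matrix_one)

lemma invertible_diag: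
  assumes "\<And>i. d i \<noteq> 0"
  shows "invertible (diag_matrix d)"
  by (rule matrix_inv_unique[of _ "diag_matrix (\<lambda>i. inverse (d i))"])
    (simp add: diag_matrix_mult assms diag_matrix_one)

lemma invertible_matrix_inv:
  fixes A :: "real^'n^'n"
  assumes "invertible A"
  shows "invertible (matrix_inv A)"
  using assms matrix_inv_cancel invertible_left_inverse invertible_right_inverse by blast

lemma invertible_scaleR:
  fixes A :: "real^'n^'n"
  assumes "invertible A" "c \<noteq> 0"
  shows "invertible (c *\<^sub>R A)"
proof (rule matrix_inv_unique)
  show "(c *\<^sub>R A) ** (inverse c *\<^sub>R matrix_inv A) = mat 1"
    using assms by (simp add: matrix_scalar_ac matrix_inv_cancel flip: scalar_matrix_assoc)
qed

lemma commute_with_diag_iff: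
  "A ** diag_matrix d = diag_matrix d ** A \<longleftrightarrow> (\<forall>i j. d i \<noteq> d j \<longrightarrow> A $ i $ j = 0)"
  unfolding vec_eq_iff matrix_mult_diag_nth diag_mult_matrix_nth
  by (metis mult.commute mult_cancel_left)

lemma matrix_mult_axis: "(A *v axis j 1) $ i = A $ i $ j"
  for A :: "real^'n^'n"
  by (simp add: matrix_vector_mult_basis column_def)

lemma axis_in_block_space: "axis j 1 \<in> block_space b (b j)"
  by (auto simp: block_space_def axis_def)

lemma axis_in_flag_space: "axis j 1 \<in> flag_space b (b j)"
  by (auto simp: flag_space_def axis_def)

lemma subspace_block_space: "subspace (block_space b j)"
  by (auto simp: block_space_def subspace_def)

lemma subspace_flag_space: "subspace (flag_space b j)"
  by (auto simp: flag_space_def subspace_def)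

text \<open>Stabilizers of flags and decompositions are defined by equality of subspaces; for an
  invertible matrix the inclusion suffices, because dimensions agree.\<close>

lemma invertible_image_eq:
  fixes A :: "real^'n^'n"
  assumes "invertible A" "subspace S" "\<And>v. v \<in> S \<Longrightarrow> A *v v \<in> S"
  shows "(*v) A ` S = S"
proof (rule subspace_dim_equal)
  have inj: "inj ((*v) A)"
    using assms(1) matrix_left_invertible_injective invertible_left_inverse by blast
  have lin: "linear ((*v) A)" by (rule matrix_vector_mul_linear)
  show "subspace ((*v) A ` S)" using assms(2) lin by (rule linear_subspace_image[rotated])
  show "dim S \<le> dim ((*v) A ` S)"
    using dim_image_eq[OF lin inj_on_subset[OF inj]] by simp
qed (use assms in auto)

text \<open>The column \<open>j\<close> of \<open>A\<close> is the image of a basis vector of block \<open>b j\<close>, so invariance of the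
  blocks can be read off the columns.\<close>

lemma preserves_blocks_iff:
  assumes "invertible A" "\<And>i. b i \<le> k"
  shows "(\<forall>i\<le>k. (*v) A ` block_space b i = block_space b i) \<longleftrightarrow> block_diagonal b A"
proof
  assume A: "\<forall>i\<le>k. (*v) A ` block_space b i = block_space b i"
  show "block_diagonal b A" unfolding block_diagonal_def
  proof (intro allI impI)
    fix i j assume "b i \<noteq> b j"
    moreover have "A *v axis j 1 \<in> block_space b (b j)"
      using A assms(2) axis_in_block_space by blast
    ultimately show "A $ i $ j = 0" by (simp add: block_space_def matrix_mult_axis)
  qed
next
  assume A: "block_diagonal b A"
  show "\<forall>i\<le>k. (*v) A ` block_space b i = block_space b i"
  proof (intro allI impI invertible_image_eq assms subspace_block_space)
    fix j and v :: "real^'a" assume v: "v \<in> block_space b j"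
    have "A $ i $ p * v $ p = 0" if "b i \<noteq> j" for i p
      using A v that by (cases "b p = j") (auto simp: block_space_def block_diagonal_def)
    then show "A *v v \<in> block_space b j"
      by (auto simp: block_space_def matrix_vector_nth simp del: mult_eq_0_iff intro!: sum.neutral)
  qed
qed

lemma preserves_flag_iff:
  assumes "invertible A" "\<And>i. b i \<le> k"
  shows "(\<forall>i\<le>k + 1. (*v) A ` flag_space b i = flag_space b i) \<longleftrightarrow> block_lower_triangular b A"
proof
  assume A: "\<forall>i\<le>k + 1. (*v) A ` flag_space b i = flag_space b i"
  show "block_lower_triangular b A" unfolding block_lower_triangular_def
  proof (intro allI impI)
    fix i j assume "b i < b j"
    moreover have "A *v axis j 1 \<in> flag_space b (b j)"
      using A assms(2) axis_in_flag_space by (metis image_eqI trans_le_add1)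
    ultimately show "A $ i $ j = 0" by (simp add: flag_space_def matrix_mult_axis)
  qed
next
  assume A: "block_lower_triangular b A"
  show "\<forall>i\<le>k + 1. (*v) A ` flag_space b i = flag_space b i"
  proof (intro allI impI invertible_image_eq assms subspace_flag_space)
    fix j and v :: "real^'a" assume v: "v \<in> flag_space b j"
    have "A $ i $ p * v $ p = 0" if "b i < j" for i p
      using A v that by (cases "b p < j") (auto simp: flag_space_def block_lower_triangular_def)
    then show "A *v v \<in> flag_space b j"
      by (auto simp: flag_space_def matrix_vector_nth simp del: mult_eq_0_iff intro!: sum.neutral)
  qed
qed

lemma span_block_spaces:
  assumes "\<And>i. b i \<le> k"
  shows "span (\<Union>i\<in>{j..k}. block_space b i) = flag_space b j"
proof
  show "span (\<Union>i\<in>{j..k}. block_space b i) \<subseteq> flag_space b j"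
    by (rule span_minimal[OF _ subspace_flag_space]) (auto simp: block_space_def flag_space_def)
  show "flag_space b j \<subseteq> span (\<Union>i\<in>{j..k}. block_space b i)"
  proof
    fix v :: "real^'a" assume v: "v \<in> flag_space b j"
    have "v $ i *\<^sub>R axis i 1 \<in> span (\<Union>i\<in>{j..k}. block_space b i)" for i
    proof (cases "b i < j")
      case True
      then show ?thesis using v by (simp add: flag_space_def span_zero)
    next
      case False
      then have "axis i 1 \<in> (\<Union>i\<in>{j..k}. block_space b i)"
        using assms axis_in_block_space by fastforce
      then show ?thesis by (intro span_mul span_base)
    qed
    then have "(\<Sum>i\<in>UNIV. v $ i *\<^sub>R axis i 1) \<in> span (\<Union>i\<in>{j..k}. block_space b i)"
      by (intro span_sum)
    then show "v \<in> span (\<Union>i\<in>{j..k}. block_space b i)"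
      using basis_expansion[of v] by (simp add: scalar_mult_eq_scaleR)
  qed
qed

lemma block_unipotent_imp_lower: "block_unipotent b N \<Longrightarrow> block_lower_triangular b N"
  unfolding block_unipotent_def block_lower_triangular_def
  by (metis less_imp_le nless_le)

text \<open>A nonzero vector keeps its components in the lowest block that it involves, so it is not
  annihilated.\<close>

lemma invertible_block_unipotent:
  assumes "block_unipotent b N"
  shows "invertible N"
proof -
  have "v = 0" if "N *v v = 0" for v
  proof (rule ccontr)
    assume "v \<noteq> 0"
    then obtain i where "v $ i \<noteq> 0" by (auto simp: vec_eq_iff)
    (* j is chosen in the lowest block in which v does not vanish. *)
    then obtain j where j: "v $ j \<noteq> 0" "\<And>i. v $ i \<noteq> 0 \<Longrightarrow> b j \<le> b i"
      using arg_min_nat_lemma[of "\<lambda>i. v $ i \<noteq> 0" i b] by blast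
    have "N $ j $ p * v $ p = (if p = j then v $ j else 0)" for p
      using j assms unfolding block_unipotent_def by (cases "v $ p = 0") auto
    then have "(N *v v) $ j = v $ j" by (simp add: matrix_vector_nth)
    with that j show False by simp
  qed
  then show ?thesis
    using matrix_left_invertible_ker invertible_left_inverse by blast
qed

lemma block_diagonal_part_mult_left:
  assumes "block_diagonal b A"
  shows "block_diagonal_part b (A ** M) = A ** block_diagonal_part b M"
proof -
  have "(\<Sum>p\<in>UNIV. A $ i $ p * M $ p $ j)
      = (\<Sum>p\<in>UNIV. A $ i $ p * (if b p = b j then M $ p $ j else 0))" if "b i = b j" for i j
    using that assms by (intro sum.cong) (auto simp: block_diagonal_def)
  moreover have "(\<Sum>p\<in>UNIV. A $ i $ p * (if b p = b j then M $ p $ j else 0)) = 0"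
    if "b i \<noteq> b j" for i j
    using that assms by (intro sum.neutral) (auto simp: block_diagonal_def)
  ultimately show ?thesis
    by (simp add: vec_eq_iff block_diagonal_part_def matrix_mult_nth)
qed

lemma block_lower_triangular_mult:
  assumes "block_lower_triangular b A" "block_lower_triangular b M"
  shows "block_lower_triangular b (A ** M)"
  unfolding block_lower_triangular_def
proof (intro allI impI)
  fix i j assume "b i < b j"
  then have "A $ i $ p * M $ p $ j = 0" for p
    using assms by (cases "b i < b p") (auto simp: block_lower_triangular_def)
  then show "(A ** M) $ i $ j = 0" unfolding matrix_mult_nth by (rule sum.neutral[rule_format])
qed

lemma block_unipotent_iff:
  "block_unipotent b N \<longleftrightarrow> block_lower_triangular b N \<and> block_diagonal_part b N = mat 1"
  by (auto simp: block_unipotent_def block_lower_triangular_def block_diagonal_part_def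
      vec_eq_iff mat_def le_less split: if_splits)

lemma block_diagonal_imp_lower: "block_diagonal b A \<Longrightarrow> block_lower_triangular b A"
  by (auto simp: block_diagonal_def block_lower_triangular_def)

text \<open>Commutation passes to the inverse matrix, which the entrywise condition does not do visibly.\<close>

lemma block_diagonal_iff_commutes: "block_diagonal b A \<longleftrightarrow>
    A ** diag_matrix (\<lambda>i. real (b i)) = diag_matrix (\<lambda>i. real (b i)) ** A"
  by (simp add: commute_with_diag_iff block_diagonal_def)

lemma block_diagonal_matrix_inv:
  assumes "block_diagonal b A" "invertible A"
  shows "block_diagonal b (matrix_inv A)"
proof -
  let ?D = "diag_matrix (\<lambda>i. real (b i))"
  have "matrix_inv A ** ?D = matrix_inv A ** (?D ** A) ** matrix_inv A"
    using assms(2) by (simp add: matrix_inv_cancel flip: matrix_mul_assoc)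
  also have "\<dots> = matrix_inv A ** (A ** ?D) ** matrix_inv A"
    using assms(1) by (simp add: block_diagonal_iff_commutes)
  also have "\<dots> = ?D ** matrix_inv A"
    using assms(2) by (simp add: matrix_inv_cancel matrix_mul_assoc)
  finally show ?thesis by (simp add: block_diagonal_iff_commutes)
qed

section \<open>Classes of matrices in the projective group\<close>

lemma group_GL: "group (GL :: (real^'n^'n) monoid)"
proof (rule groupI)
  fix A :: "real^'n^'n" assume "A \<in> carrier GL"
  then show "\<exists>B\<in>carrier GL. B \<otimes>\<^bsub>GL\<^esub> A = \<one>\<^bsub>GL\<^esub>"
    using matrix_inv_cancel(2) invertible_matrix_inv by (auto simp: GL_def)
qed (auto simp: GL_def invertible_mult matrix_mul_assoc invertible_one)

lemma proj_eq: "proj A = {c *\<^sub>R A | c. c \<noteq> 0}"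
proof -
  have "proj A = (\<lambda>h. h ** A) ` {c *\<^sub>R mat 1 | c. c \<noteq> 0}"
    by (auto simp: proj_def r_coset_def GL_def scalar_matrices_def)
  also have "\<dots> = {c *\<^sub>R A | c. c \<noteq> 0}"
    by (force simp flip: scalar_matrix_assoc)
  finally show ?thesis .
qed

lemma normal_scalar_matrices: "scalar_matrices \<lhd> (GL :: (real^'n^'n) monoid)"
proof -
  interpret group "GL :: (real^'n^'n) monoid" by (rule group_GL)
  have inv: "invertible (c *\<^sub>R (mat 1 :: real^'n^'n))" if "c \<noteq> 0" for c
    using that by (intro invertible_scaleR invertible_one)
  have "subgroup scalar_matrices (GL :: (real^'n^'n) monoid)"
  proof (rule subgroupI)
    fix a :: "real^'n^'n" assume "a \<in> scalar_matrices"
    then obtain c where c: "c \<noteq> 0" "a = c *\<^sub>R mat 1" by (auto simp: scalar_matrices_def)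
    then have "inv\<^bsub>GL\<^esub> a = inverse c *\<^sub>R mat 1"
      by (intro inv_equality) (auto simp: GL_def inv matrix_scalar_ac simp flip: scalar_matrix_assoc)
    with c show "inv\<^bsub>GL\<^esub> a \<in> scalar_matrices"
      by (auto simp: scalar_matrices_def intro!: exI[of _ "inverse c"])
  next
    fix a b :: "real^'n^'n" assume "a \<in> scalar_matrices" "b \<in> scalar_matrices"
    then show "a \<otimes>\<^bsub>GL\<^esub> b \<in> scalar_matrices"
      by (force simp: scalar_matrices_def GL_def matrix_scalar_ac simp flip: scalar_matrix_assoc)
  qed (auto simp: scalar_matrices_def GL_def inv intro: exI[of _ 1])
  then show ?thesis
    by (rule normalI)
      (auto simp: GL_def r_coset_def l_coset_def scalar_matrices_def matrix_scalar_ac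
        simp flip: scalar_matrix_assoc)
qed

lemma group_PGL: "group (PGL :: (real^'n^'n) set monoid)"
  unfolding PGL_def by (rule normal.factorgroup_is_group[OF normal_scalar_matrices])

lemma carrier_PGL: "carrier PGL = {proj A | A. invertible A}"
  by (auto simp: PGL_def FactGroup_def RCOSETS_def proj_def GL_def)

lemma proj_in_PGL: "invertible A \<Longrightarrow> proj A \<in> carrier PGL"
  by (auto simp: carrier_PGL)

lemma self_in_proj: "A \<in> proj A"
  unfolding proj_eq by (force intro: exI[of _ 1])

lemma proj_eqD: "proj A = proj B \<Longrightarrow> \<exists>c\<noteq>0. A = c *\<^sub>R B"
  using self_in_proj[of A] by (auto simp: proj_eq)

lemma proj_scaleR: "c \<noteq> 0 \<Longrightarrow> proj (c *\<^sub>R A) = proj A"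
  by (force simp: proj_eq intro: exI[of _ "_ / c"])

text \<open>The class of a singular matrix contains no invertible matrix, so membership of a class in a
  subset of the group already yields invertibility of its representative.\<close>

lemma proj_in_PGL_iff: "proj A \<in> carrier PGL \<longleftrightarrow> invertible A"
proof
  assume "proj A \<in> carrier PGL"
  then obtain B where "invertible B" "proj A = proj B" by (auto simp: carrier_PGL)
  then show "invertible A" using proj_eqD invertible_scaleR by blast
qed (rule proj_in_PGL)

lemma mult_PGL: "proj A \<otimes>\<^bsub>PGL\<^esub> proj B = proj (A ** B)"
proof -
  have "proj A \<otimes>\<^bsub>PGL\<^esub> proj B = {(a *\<^sub>R A) ** (b *\<^sub>R B) | a b. a \<noteq> 0 \<and> b \<noteq> 0}"
    by (auto simp: PGL_def FactGroup_def set_mult_def GL_def proj_eq)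
  also have "\<dots> = {(a * b) *\<^sub>R (A ** B) | a b. a \<noteq> 0 \<and> b \<noteq> 0}"
    by (simp add: matrix_scalar_ac ac_simps flip: scalar_matrix_assoc)
  also have "\<dots> = proj (A ** B)"
    unfolding proj_eq by (auto, metis mult.right_neutral zero_neq_one)
  finally show ?thesis .
qed

lemma one_PGL: "\<one>\<^bsub>PGL\<^esub> = proj (mat 1)"
  by (auto simp: PGL_def FactGroup_def proj_eq scalar_matrices_def)

lemma inv_PGL:
  assumes "invertible A"
  shows "inv\<^bsub>PGL\<^esub> (proj A) = proj (matrix_inv A)"
  using assms
  by (intro group.inv_equality[OF group_PGL])
    (auto simp: mult_PGL one_PGL matrix_inv_cancel proj_in_PGL invertible_matrix_inv)

lemma proj_ball_iff:
  assumes "\<And>c A. c \<noteq> 0 \<Longrightarrow> P A \<Longrightarrow> P (c *\<^sub>R A)"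
  shows "(\<forall>A\<in>proj A. P A) \<longleftrightarrow> P A"
  using assms self_in_proj[of A] by (auto simp: proj_eq)

lemma matrix_inv_scaleR:
  fixes A :: "real^'n^'n"
  assumes "invertible A" "c \<noteq> 0"
  shows "matrix_inv (c *\<^sub>R A) = inverse c *\<^sub>R matrix_inv A"
proof (rule matrix_inv_unique(2))
  show "(c *\<^sub>R A) ** (inverse c *\<^sub>R matrix_inv A) = mat 1"
    using assms by (simp add: matrix_scalar_ac matrix_inv_cancel flip: scalar_matrix_assoc)
qed

lemma Ad_proj_eq_iff:
  assumes "invertible A"
  shows "Ad (proj A) X = X \<longleftrightarrow> A ** X = X ** A"
proof -
  have conj: "B ** X ** matrix_inv B = A ** X ** matrix_inv A" if B: "B \<in> proj A" for B
  proof -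
    obtain c where c: "c \<noteq> 0" "B = c *\<^sub>R A" using B unfolding proj_eq by blast
    have "B ** X ** matrix_inv B = (c *\<^sub>R A) ** X ** (inverse c *\<^sub>R matrix_inv A)"
      unfolding c(2) matrix_inv_scaleR[OF assms c(1)] ..
    also have "\<dots> = A ** X ** matrix_inv A"
      using c(1) by (simp add: matrix_scalar_ac flip: scalar_matrix_assoc)
    finally show ?thesis .
  qed
  have "Ad (proj A) X = A ** X ** matrix_inv A"
    unfolding Ad_def
  proof (rule the_equality)
    show "\<forall>B\<in>proj A. B ** X ** matrix_inv B = A ** X ** matrix_inv A" using conj by (rule ballI)
    show "Y = A ** X ** matrix_inv A" if "\<forall>B\<in>proj A. B ** X ** matrix_inv B = Y" for Y
      using bspec[OF that self_in_proj] by (rule sym)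
  qed
  moreover have "A ** X ** matrix_inv A = X \<longleftrightarrow> A ** X = X ** A"
  proof
    assume "A ** X ** matrix_inv A = X"
    then have "A ** X ** (matrix_inv A ** A) = X ** A" by (simp add: matrix_mul_assoc)
    then show "A ** X = X ** A" by (simp add: matrix_inv_cancel assms)
  next
    assume "A ** X = X ** A"
    then have "A ** X ** matrix_inv A = X ** (A ** matrix_inv A)" by (simp add: matrix_mul_assoc)
    then show "A ** X ** matrix_inv A = X" by (simp add: matrix_inv_cancel assms)
  qed
  ultimately show ?thesis by simp
qed

lemma P_GL_sum_block_iff:
  assumes "\<And>i. b i \<le> k" "\<And>i. i \<le> k \<Longrightarrow> E i = block_space b i"
  shows "proj A \<in> P_GL_sum k E \<longleftrightarrow> invertible A \<and> block_diagonal b A"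
proof -
  have "(\<forall>A\<in>proj A. \<forall>i\<le>k. (*v) A ` E i = E i) \<longleftrightarrow> block_diagonal b A" if "invertible A"
  proof -
    have "invertible C" if "C \<in> proj A" for C
      using that \<open>invertible A\<close> by (auto simp: proj_eq invertible_scaleR)
    then have "(\<forall>A\<in>proj A. \<forall>i\<le>k. (*v) A ` E i = E i) \<longleftrightarrow> (\<forall>A\<in>proj A. block_diagonal b A)"
      using assms(2) preserves_blocks_iff[where b = b and k = k, OF _ assms(1)] by (intro ball_cong) auto
    also have "\<dots> \<longleftrightarrow> block_diagonal b A"
      by (rule proj_ball_iff) (simp add: block_diagonal_def)
    finally show ?thesis .
  qed
  then show ?thesis by (auto simp: P_GL_sum_def proj_in_PGL_iff)
qed

lemma PGL_flag_block_iff: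
  assumes "\<And>i. b i \<le> k" "\<And>i. i \<le> k + 1 \<Longrightarrow> V i = flag_space b i"
  shows "proj A \<in> PGL_flag k V \<longleftrightarrow> invertible A \<and> block_lower_triangular b A"
proof -
  have "(\<forall>A\<in>proj A. \<forall>i\<le>k + 1. (*v) A ` V i = V i) \<longleftrightarrow> block_lower_triangular b A" if "invertible A"
  proof -
    have "invertible C" if "C \<in> proj A" for C
      using that \<open>invertible A\<close> by (auto simp: proj_eq invertible_scaleR)
    then have "(\<forall>A\<in>proj A. \<forall>i\<le>k + 1. (*v) A ` V i = V i)
        \<longleftrightarrow> (\<forall>A\<in>proj A. block_lower_triangular b A)"
      using assms(2) preserves_flag_iff[where b = b and k = k, OF _ assms(1)] by (intro ball_cong) auto
    also have "\<dots> \<longleftrightarrow> block_lower_triangular b A"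
      by (rule proj_ball_iff) (simp add: block_lower_triangular_def)
    finally show ?thesis .
  qed
  then show ?thesis by (auto simp: PGL_flag_def proj_in_PGL_iff)
qed

section \<open>Convergence in the projective group\<close>

text \<open>The quotient map is continuous.\<close>

lemma limitin_proj:
  fixes F :: "real \<Rightarrow> real^'n^'n"
  assumes "\<And>t. invertible (F t)" "invertible A" "(F \<longlongrightarrow> A) at_top"
  shows "limitin PGL_topology (\<lambda>t. proj (F t)) (proj A) at_top"
  unfolding limitin_def
proof (intro conjI allI impI)
  have "{A \<in> carrier GL. proj A \<in> carrier PGL} = (carrier GL :: (real^'n^'n) set)"
    by (auto simp: GL_def proj_in_PGL_iff)
  then have "openin PGL_topology (carrier (PGL :: (real^'n^'n) set monoid))"
    by (simp add: openin_PGL_topology)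
  then show "proj A \<in> topspace PGL_topology"
    using assms(2) openin_subset proj_in_PGL by blast
  fix U :: "(real^'n^'n) set set" assume U: "openin PGL_topology U \<and> proj A \<in> U"
  then obtain O' where O': "open O'" "{A \<in> carrier GL. proj A \<in> U} = carrier GL \<inter> O'"
    by (auto simp: openin_PGL_topology openin_open)
  then have "A \<in> O'" using U assms(2) by (auto simp: GL_def)
  then have "\<forall>\<^sub>F t in at_top. F t \<in> O'"
    using O'(1) assms(3) topological_tendstoD by blast
  then show "\<forall>\<^sub>F t in at_top. proj (F t) \<in> U"
    by (rule eventually_mono) (use O'(2) assms(1) in \<open>auto simp: GL_def\<close>)
qed

text \<open>A function that is homogeneous of degree \<open>0\<close> factors through the quotient, and preimages of
  open sets under it are saturated, hence open in the quotient topology.\<close>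

lemma limitin_proj_tendsto:
  fixes F :: "real \<Rightarrow> real^'n^'n" and \<phi> :: "real^'n^'n \<Rightarrow> real"
  assumes lim: "limitin PGL_topology (\<lambda>t. proj (F t)) (proj A) at_top"
    and inv: "\<And>t. invertible (F t)" "invertible A"
    and cont: "continuous_on {A. invertible A} \<phi>"
    and homog: "\<And>c A. c \<noteq> 0 \<Longrightarrow> \<phi> (c *\<^sub>R A) = \<phi> A"
  shows "((\<lambda>t. \<phi> (F t)) \<longlongrightarrow> \<phi> A) at_top"
proof (rule topological_tendstoI)
  fix S assume S: "open S" "\<phi> A \<in> S"
  define U where "U = {proj B | B. invertible B \<and> \<phi> B \<in> S}"
  have U_iff: "proj B \<in> U \<longleftrightarrow> invertible B \<and> \<phi> B \<in> S" for B
  proof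
    assume "proj B \<in> U"
    then obtain B' where B': "proj B = proj B'" "invertible B'" "\<phi> B' \<in> S" unfolding U_def by blast
    from proj_eqD[OF B'(1)] obtain c where "c \<noteq> 0" "B = c *\<^sub>R B'" by blast
    with B' show "invertible B \<and> \<phi> B \<in> S" by (simp add: invertible_scaleR homog)
  qed (auto simp: U_def)
  have "{B \<in> carrier GL. proj B \<in> U} = {B. invertible B} \<inter> \<phi> -` S"
    by (auto simp: GL_def U_iff)
  moreover have "openin (top_of_set {B. invertible B}) ({B. invertible B} \<inter> \<phi> -` S)"
    using cont S(1) by (rule continuous_openin_preimage_gen)
  ultimately have "openin PGL_topology U"
    by (auto simp: openin_PGL_topology GL_def carrier_PGL U_def)
  then have "\<forall>\<^sub>F t in at_top. proj (F t) \<in> U"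
    using lim S inv by (auto simp: limitin_def U_iff)
  then show "\<forall>\<^sub>F t in at_top. \<phi> (F t) \<in> S"
    by (rule eventually_mono) (simp add: U_iff)
qed

text \<open>Convergence of classes allows rescaling of the representatives by factors depending on \<open>t\<close>.
  Constant diagonal entries exclude this. The quotients of products of two entries by the
  squared norm are homogeneous of degree \<open>0\<close>, so they converge to their values at the identity, which are
  \<open>1/n\<close> for two diagonal entries. As the numerators are constant, the diagonal entries do not
  vanish and the norm converges; multiplying by it recovers limits of the entries.\<close>

lemma limitin_proj_one:
  fixes F :: "real \<Rightarrow> real^'n^'n"
  assumes lim: "limitin PGL_topology (\<lambda>t. proj (F t)) (proj (mat 1)) at_top"
    and inv: "\<And>t. invertible (F t)"
    and const: "\<And>t i. F t $ i $ i = a i"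
  shows "\<exists>c\<noteq>0. \<forall>i. a i = c" "i \<noteq> j \<Longrightarrow> ((\<lambda>t. F t $ i $ j) \<longlongrightarrow> 0) at_top"
proof -
  define \<phi> :: "'n \<Rightarrow> 'n \<Rightarrow> 'n \<Rightarrow> 'n \<Rightarrow> real^'n^'n \<Rightarrow> real" where
    "\<phi> i j p q A = A $ i $ j * A $ p $ q / (A \<bullet> A)" for i j p q A
  define n where "n = real CARD('n)"
  have n: "n > 0" by (simp add: n_def)
  have inner_one: "(mat 1 :: real^'n^'n) \<bullet> mat 1 = n"
    by (simp add: inner_vec_def mat_def n_def if_distrib[of "\<lambda>x. x * _"] cong: if_cong)
  have nz: "A \<noteq> 0" if "invertible A" for A :: "real^'n^'n"
  proof
    assume "A = 0"
    then have "(A ** matrix_inv A) $ i $ i = 0" for i by (simp add: matrix_mult_nth)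
    then show False using matrix_inv_cancel(1)[OF that] by (simp add: mat_def)
  qed
  have \<phi>_lim: "((\<lambda>t. \<phi> i j p q (F t)) \<longlongrightarrow> \<phi> i j p q (mat 1)) at_top" for i j p q
  proof (rule limitin_proj_tendsto[OF lim inv invertible_one])
    show "continuous_on {A. invertible A} (\<phi> i j p q)"
      unfolding \<phi>_def using nz by (intro continuous_intros) auto
    show "\<phi> i j p q (c *\<^sub>R A) = \<phi> i j p q A" if "c \<noteq> 0" for c A
      using that by (simp add: \<phi>_def)
  qed
  have diag_lim: "((\<lambda>t. a i * a j / (F t \<bullet> F t)) \<longlongrightarrow> 1 / n) at_top" for i j
    using \<phi>_lim[of i i j j] by (simp add: \<phi>_def const inner_one mat_one_nth)
  have a_nz: "a i \<noteq> 0" for i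
  proof
    assume "a i = 0"
    with diag_lim[of i i] n show False by (simp add: tendsto_const_iff)
  qed
  have norm_lim: "((\<lambda>t. F t \<bullet> F t) \<longlongrightarrow> a i * a i * n) at_top" for i
    using tendsto_divide[OF tendsto_const[of "a i * a i"] diag_lim[of i i]] n a_nz[of i]
    by simp
  have "a i = a j" for i j
  proof -
    have "((\<lambda>t. a i * a j / (F t \<bullet> F t) * (F t \<bullet> F t)) \<longlongrightarrow> 1 / n * (a i * a i * n)) at_top"
      by (intro tendsto_mult diag_lim norm_lim)
    then have "a i * a j = a i * a i"
      using n nz[OF inv] by (simp add: tendsto_const_iff)
    then show ?thesis using a_nz by simp
  qed
  then show "\<exists>c\<noteq>0. \<forall>i. a i = c" using a_nz by metis
  show "((\<lambda>t. F t $ i $ j) \<longlongrightarrow> 0) at_top" if "i \<noteq> j"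
  proof -
    have "((\<lambda>t. \<phi> i j i j (F t) * (F t \<bullet> F t)) \<longlongrightarrow> \<phi> i j i j (mat 1) * (a i * a i * n)) at_top"
      by (intro tendsto_mult \<phi>_lim norm_lim)
    then have "((\<lambda>t. (F t $ i $ j)\<^sup>2) \<longlongrightarrow> 0) at_top"
      using nz[OF inv] that by (simp add: \<phi>_def mat_one_nth power2_eq_square)
    from tendsto_real_sqrt[OF this] show ?thesis by (simp add: tendsto_rabs_zero_iff)
  qed
qed

section \<open>The contracting group of a diagonal matrix\<close>

lemma matrix_power_diag: "(((**) (diag_matrix d)) ^^ m) (mat 1) = diag_matrix (\<lambda>i. d i ^ m)"
  by (induction m) (simp_all add: diag_matrix_one diag_matrix_mult)

lemma matrix_exp_diag: "matrix_exp (diag_matrix d) = diag_matrix (\<lambda>i. exp (d i))"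
proof -
  have "(\<lambda>m. (1 / fact m) *\<^sub>R diag_matrix (\<lambda>i. d i ^ m)) sums diag_matrix (\<lambda>i. exp (d i))"
    unfolding sums_def
  proof (intro vec_tendstoI)
    fix i j
    show "(\<lambda>n. (\<Sum>m<n. (1 / fact m) *\<^sub>R diag_matrix (\<lambda>i. d i ^ m)) $ i $ j)
        \<longlonglongrightarrow> diag_matrix (\<lambda>i. exp (d i)) $ i $ j"
      using exp_converges[of "d i"] by (cases "i = j") (simp_all add: sums_def divide_inverse mult.commute)
  qed
  then show ?thesis
    unfolding matrix_exp_def matrix_power_diag by (rule sums_unique[symmetric])
qed

lemma conjugate_by_one_param:
  fixes A :: "real^'n^'n" and d :: "'n \<Rightarrow> real"
  assumes "invertible A"
  defines "F \<equiv> \<lambda>t. \<chi> i j. A $ i $ j * exp (t * (d j - d i))"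
  shows "inv\<^bsub>PGL\<^esub> (one_param (diag_matrix d) t) \<otimes>\<^bsub>PGL\<^esub> proj A \<otimes>\<^bsub>PGL\<^esub> one_param (diag_matrix d) t
      = proj (F t)" (is ?thesis1)
    and "invertible (F t)" (is ?thesis2)
proof -
  define D where "D = diag_matrix (\<lambda>i::'n. exp (t * d i))"
  have D: "one_param (diag_matrix d) t = proj D"
  proof -
    have "t *\<^sub>R diag_matrix d = diag_matrix (\<lambda>i. t * d i)" by (simp add: vec_eq_iff)
    then show ?thesis by (simp add: one_param_def matrix_exp_diag D_def)
  qed
  have inv_D: "invertible D" "matrix_inv D = diag_matrix (\<lambda>i. inverse (exp (t * d i)))"
    by (simp_all add: D_def invertible_diag matrix_inv_diag)
  have F: "F t = matrix_inv D ** A ** D"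
    unfolding inv_D(2) unfolding D_def F_def
    by (simp add: vec_eq_iff matrix_mult_diag_nth diag_mult_matrix_nth right_diff_distrib exp_diff
        divide_inverse)
  show ?thesis1 by (simp add: D inv_PGL inv_D(1) mult_PGL F)
  show ?thesis2 unfolding F using inv_D(1) assms(1) by (intro invertible_mult invertible_matrix_inv)
qed

text \<open>If \<open>b i \<le> b j\<close>, then the entry \<open>(i, j)\<close> of the conjugate does not shrink as \<open>t\<close> grows, so for
  \<open>i \<noteq> j\<close> it tends to \<open>0\<close> only if it vanishes. All other off-diagonal entries decay exponentially.\<close>

lemma N_plus_diag:
  assumes ord: "\<And>i j. d i < d j \<longleftrightarrow> b i < b j"
  shows "N_plus (diag_matrix d) = {proj N | N. block_unipotent b N}"
proof (intro equalityI subsetI)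
  fix g assume "g \<in> N_plus (diag_matrix d)"
  then obtain A where A: "invertible A" "g = proj A" "proj A \<in> N_plus (diag_matrix d)"
    by (auto simp: N_plus_def carrier_PGL)
  define F where "F t = (\<chi> i j. A $ i $ j * exp (t * (d j - d i)))" for t
  note F = conjugate_by_one_param[OF A(1), where d = d, folded F_def]
  have lim: "limitin PGL_topology (\<lambda>t. proj (F t)) (proj (mat 1)) at_top"
    using A(3) by (simp add: N_plus_def F(1) one_PGL)
  obtain c where c: "c \<noteq> 0" "\<And>i. A $ i $ i = c"
    using limitin_proj_one(1)[OF lim F(2), of "\<lambda>i. A $ i $ i"] by (auto simp: F_def)
  have "A $ i $ j = 0" if "b i \<le> b j" "i \<noteq> j" for i j
  proof -
    have "d i \<le> d j" using ord[of j i] that(1) by linarith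
    then have "\<forall>\<^sub>F t in at_top. \<bar>A $ i $ j\<bar> \<le> \<bar>F t $ i $ j\<bar>"
      by (intro eventually_mono[OF eventually_ge_at_top[of 0]]) (simp add: F_def abs_mult mult_le_cancel_left1)
    moreover have "((\<lambda>t. \<bar>F t $ i $ j\<bar>) \<longlongrightarrow> \<bar>0\<bar>) at_top"
      using limitin_proj_one(2)[OF lim F(2), of "\<lambda>i. A $ i $ i"] that(2)
      by (intro tendsto_rabs) (auto simp: F_def)
    ultimately have "\<bar>A $ i $ j\<bar> \<le> \<bar>0\<bar>"
      by (intro tendsto_lowerbound[of _ _ at_top]) auto
    then show ?thesis by simp
  qed
  then have "block_unipotent b (inverse c *\<^sub>R A)"
    using c by (simp add: block_unipotent_def)
  moreover have "g = proj (inverse c *\<^sub>R A)" using c A(2) by (simp add: proj_scaleR)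
  ultimately show "g \<in> {proj N | N. block_unipotent b N}" by blast
next
  fix g assume "g \<in> {proj N | N. block_unipotent b N}"
  then obtain N where N: "block_unipotent b N" "g = proj N" by blast
  note inv_N = invertible_block_unipotent[OF N(1)]
  define F where "F t = (\<chi> i j. N $ i $ j * exp (t * (d j - d i)))" for t
  note F = conjugate_by_one_param[OF inv_N, where d = d, folded F_def]
  have "(F \<longlongrightarrow> mat 1) at_top"
  proof (intro vec_tendstoI)
    fix i j
    show "((\<lambda>t. F t $ i $ j) \<longlongrightarrow> mat 1 $ i $ j) at_top"
    proof (cases "b i \<le> b j")
      case True
      then have "F t $ i $ j = mat 1 $ i $ j" for t
        using N(1) by (simp add: F_def block_unipotent_def mat_def)
      then show ?thesis by simp
    next
      case False
      then have "d j - d i < 0" using ord[of j i] by simp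
      then have "((\<lambda>t. exp (t * (d j - d i))) \<longlongrightarrow> 0) at_top"
        by real_asymp
      then have "((\<lambda>t. N $ i $ j * exp (t * (d j - d i))) \<longlongrightarrow> 0) at_top"
        by (rule tendsto_mult_right_zero)
      then show ?thesis using False by (auto simp: F_def mat_def)
    qed
  qed
  then have "limitin PGL_topology (\<lambda>t. proj (F t)) (proj (mat 1)) at_top"
    by (intro limitin_proj F invertible_one)
  then show "g \<in> N_plus (diag_matrix d)"
    by (simp add: N_plus_def F(1) one_PGL N(2) proj_in_PGL inv_N)
qed

section \<open>The flag unipotent subgroup\<close>

text \<open>As \<open>A\<close> maps \<open>W\<close> onto itself, both sides are cosets of \<open>W\<close>, so they agree as soon as they share a
  point.\<close>

lemma image_coset_eq_scale_iff:
  fixes A :: "real^'n^'n"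
  assumes W: "subspace W" "(*v) A ` W = W"
  shows "(*v) A ` ((+) v ` W) = coset_scale W c ((+) v ` W) \<longleftrightarrow> A *v v - c *\<^sub>R v \<in> W"
proof
  assume eq: "(*v) A ` ((+) v ` W) = coset_scale W c ((+) v ` W)"
  have "A *v v \<in> (*v) A ` ((+) v ` W)"
    using subspace_0[OF W(1)] by (force intro: image_eqI[of _ _ 0])
  then obtain u w where u: "u \<in> W" "w \<in> W" "A *v v = c *\<^sub>R (v + u) + w"
    unfolding eq by (auto simp: coset_scale_def)
  from u(3) have "A *v v - c *\<^sub>R v = c *\<^sub>R u + w" by (simp add: algebra_simps)
  with u(1,2) show "A *v v - c *\<^sub>R v \<in> W"
    using W(1) by (simp only: subspace_add subspace_scale)
next
  assume v: "A *v v - c *\<^sub>R v \<in> W"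
  show "(*v) A ` ((+) v ` W) = coset_scale W c ((+) v ` W)"
  proof (intro equalityI subsetI)
    fix y assume "y \<in> (*v) A ` ((+) v ` W)"
    then obtain u where u: "u \<in> W" "y = A *v (v + u)" by blast
    (* The coset scaling adds W once more, so v itself may serve as the point to be scaled. *)
    then have "y = c *\<^sub>R (v + 0) + ((A *v v - c *\<^sub>R v) + A *v u)"
      by (simp add: matrix_vector_right_distrib)
    moreover have "(A *v v - c *\<^sub>R v) + A *v u \<in> W"
      using W u v by (intro subspace_add) auto
    ultimately show "y \<in> coset_scale W c ((+) v ` W)"
      unfolding coset_scale_def using subspace_0[OF W(1)] by blast
  next
    fix y assume "y \<in> coset_scale W c ((+) v ` W)"
    then obtain u w where u: "u \<in> W" "w \<in> W" "y = c *\<^sub>R (v + u) + w"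
      by (auto simp: coset_scale_def)
    have "c *\<^sub>R u + w - (A *v v - c *\<^sub>R v) \<in> W"
      by (rule subspace_diff[OF W(1) subspace_add[OF W(1) subspace_scale[OF W(1) u(1)] u(2)] v])
    then obtain x where x: "x \<in> W" "A *v x = c *\<^sub>R u + w - (A *v v - c *\<^sub>R v)"
      using W(2) by (metis imageE)
    then have "y = A *v (v + x)"
      using u(3) by (simp add: matrix_vector_right_distrib algebra_simps)
    then show "y \<in> (*v) A ` ((+) v ` W)" using x(1) by blast
  qed
qed

text \<open>Modulo the next step of the flag, a vector retains exactly its components in the current
  block; testing on the basis vectors of that block gives the conditions on the entries.\<close>

lemma congruent_to_scalar_iff:
  assumes "\<And>i. b i \<le> k"
  shows "(\<forall>i\<le>k. \<forall>v\<in>flag_space b i. A *v v - c *\<^sub>R v \<in> flag_space b (Suc i))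
    \<longleftrightarrow> (\<forall>i j. b i \<le> b j \<longrightarrow> A $ i $ j = (if i = j then c else 0))" (is "?L \<longleftrightarrow> ?R")
proof
  assume L: ?L
  show ?R
  proof (intro allI impI)
    fix i j assume "b i \<le> b j"
    moreover have "A *v axis j 1 - c *\<^sub>R axis j 1 \<in> flag_space b (Suc (b j))"
      using L assms axis_in_flag_space by blast
    ultimately have "(A *v axis j 1 - c *\<^sub>R axis j 1) $ i = 0" by (simp add: flag_space_def)
    then show "A $ i $ j = (if i = j then c else 0)"
      by (simp add: matrix_mult_axis) (simp add: axis_def split: if_splits)
  qed
next
  assume R: ?R
  show ?L
  proof (intro allI impI ballI)
    fix i v assume v: "v \<in> flag_space b i"
    have "(A *v v) $ p = c * v $ p" if "b p \<le> i" for p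
    proof -
      have "A $ p $ q * v $ q = (if q = p then c * v $ p else 0)" for q
        using R v that by (cases "b q < i") (auto simp: flag_space_def)
      then show ?thesis by (simp add: matrix_vector_nth)
    qed
    then show "A *v v - c *\<^sub>R v \<in> flag_space b (Suc i)" by (simp add: flag_space_def)
  qed
qed

lemma graded_map_eq_scalar_iff:
  fixes A :: "real^'n^'n"
  assumes b: "\<And>i. b i \<le> k" and V: "\<And>i. i \<le> k + 1 \<Longrightarrow> V i = flag_space b i"
    and A: "invertible A" "block_lower_triangular b A"
  shows "graded_map k V A
        = (\<lambda>i\<in>{..k}. \<lambda>C\<in>quotient_space (V i) (V (Suc i)). coset_scale (V (Suc i)) c C)
    \<longleftrightarrow> (\<forall>i j. b i \<le> b j \<longrightarrow> A $ i $ j = (if i = j then c else 0))"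
proof -
  have "(*v) A ` V (Suc i) = V (Suc i)" "subspace (V (Suc i))" if "i \<le> k" for i
    using that V preserves_flag_iff[where b = b and k = k, OF A(1) b] A(2)
    by (simp_all add: subspace_flag_space)
  note coset = image_coset_eq_scale_iff[OF this(2,1)]
  have "graded_map k V A
        = (\<lambda>i\<in>{..k}. \<lambda>C\<in>quotient_space (V i) (V (Suc i)). coset_scale (V (Suc i)) c C)
    \<longleftrightarrow> (\<forall>i\<le>k. \<forall>C\<in>quotient_space (V i) (V (Suc i)). (*v) A ` C = coset_scale (V (Suc i)) c C)"
    unfolding graded_map_def restrict_def fun_eq_iff by auto
  also have "\<dots> \<longleftrightarrow> (\<forall>i\<le>k. \<forall>v\<in>V i. A *v v - c *\<^sub>R v \<in> V (Suc i))"
    by (simp add: quotient_space_def coset)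
  also have "\<dots> \<longleftrightarrow> (\<forall>i\<le>k. \<forall>v\<in>flag_space b i. A *v v - c *\<^sub>R v \<in> flag_space b (Suc i))"
    using V by simp
  finally show ?thesis by (simp add: congruent_to_scalar_iff[OF b])
qed

text \<open>The neutral element of the quotient by the scalars is the set of scalars itself, so a class lies
  in the kernel iff its representatives induce exactly the scalars. One representative then induces a
  scalar \<open>c\<close>, and dividing it by \<open>c\<close> makes it unipotent.\<close>

lemma flag_unipotent_eq:
  fixes V :: "nat \<Rightarrow> (real^'n) set"
  assumes b: "\<And>i. b i \<le> k" and V: "\<And>i. i \<le> k + 1 \<Longrightarrow> V i = flag_space b i"
  shows "flag_unipotent k V = {proj N | N. block_unipotent b N}"
proof -
  have mem: "g \<in> flag_unipotent k V \<longleftrightarrow> g \<in> PGL_flag k V \<and> graded_map k V ` g = graded_scalars k V" for g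
    by (simp add: flag_unipotent_def kernel_def graded_PGL_def flag_projection_def)
  note flag = PGL_flag_block_iff[of b k V, OF b V]
  show ?thesis
  proof (intro equalityI subsetI)
    fix g assume g: "g \<in> flag_unipotent k V"
    then have "g \<in> carrier PGL" by (simp add: mem PGL_flag_def)
    then obtain A where A: "g = proj A" "invertible A" by (auto simp: carrier_PGL)
    then have lower: "block_lower_triangular b A" using g mem flag by simp
    have "graded_map k V A \<in> graded_scalars k V"
      using g A(1) self_in_proj unfolding mem by blast
    then obtain c where c: "c \<noteq> 0" "\<forall>i j. b i \<le> b j \<longrightarrow> A $ i $ j = (if i = j then c else 0)"
      unfolding graded_scalars_def using graded_map_eq_scalar_iff[of b k V, OF b V A(2) lower] by auto
    then have "block_unipotent b (inverse c *\<^sub>R A)" by (simp add: block_unipotent_def)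
    moreover have "g = proj (inverse c *\<^sub>R A)" using c(1) A(1) by (simp add: proj_scaleR)
    ultimately show "g \<in> {proj N | N. block_unipotent b N}" by blast
  next
    fix g assume "g \<in> {proj N | N. block_unipotent b N}"
    then obtain N where N: "g = proj N" "block_unipotent b N" by blast
    note inv_N = invertible_block_unipotent[OF N(2)] and lower = block_unipotent_imp_lower[OF N(2)]
    have "graded_map k V (c *\<^sub>R N)
        = (\<lambda>i\<in>{..k}. \<lambda>C\<in>quotient_space (V i) (V (Suc i)). coset_scale (V (Suc i)) c C)"
      if "c \<noteq> 0" for c
    proof (subst graded_map_eq_scalar_iff[of b k V, OF b V])
      show "invertible (c *\<^sub>R N)" using inv_N that by (rule invertible_scaleR)
      show "block_lower_triangular b (c *\<^sub>R N)"
        using lower by (simp add: block_lower_triangular_def)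
    qed (use N(2) in \<open>auto simp: block_unipotent_def\<close>)
    then have "graded_map k V ` g = graded_scalars k V"
      unfolding N(1) proj_eq graded_scalars_def setcompr_eq_image image_image
      by (intro image_cong) simp_all
    then show "g \<in> flag_unipotent k V" using N(1) inv_N lower by (simp add: mem flag)
  qed
qed

section \<open>The limit group in block form\<close>

text \<open>Commuting with a diagonal matrix kills precisely the entries that link different diagonal
  values.\<close>

lemma centralizer_in_diag:
  assumes "H \<subseteq> carrier PGL" "\<And>i j. d i = d j \<longleftrightarrow> b i = b j"
  shows "centralizer_in H (diag_matrix d) = {proj A | A. proj A \<in> H \<and> block_diagonal b A}"
proof -
  have "Ad (proj A) (diag_matrix d) = diag_matrix d \<longleftrightarrow> block_diagonal b A" if "proj A \<in> H" for A
  proof -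
    have "invertible A" using that assms(1) proj_in_PGL_iff by blast
    then show ?thesis
      using assms(2) by (simp add: Ad_proj_eq_iff commute_with_diag_iff block_diagonal_def)
  qed
  moreover have "\<exists>A. h = proj A" if "h \<in> H" for h
    using that assms(1) by (auto simp: carrier_PGL)
  ultimately show ?thesis unfolding centralizer_in_def by blast
qed

lemma block_diagonal_block_diagonal_part: "block_diagonal b (block_diagonal_part b M)"
  by (simp add: block_diagonal_def block_diagonal_part_def)

text \<open>Taking the block diagonal part is compatible with multiplication by block diagonal
  matrices. So the product of \<open>A\<close> with a unipotent matrix has block diagonal part \<open>A\<close>, and conversely
  a block lower triangular \<open>M\<close> with invertible block diagonal part \<open>A\<close> is \<open>A\<close> times the unipotent
  matrix \<open>matrix_inv A ** M\<close>.\<close>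

lemma block_diagonal_times_unipotent:
  assumes "H \<subseteq> carrier PGL"
  shows "{proj A | A. proj A \<in> H \<and> block_diagonal b A} <#>\<^bsub>PGL\<^esub> {proj N | N. block_unipotent b N}
    = {proj M | M. block_lower_triangular b M \<and> proj (block_diagonal_part b M) \<in> H}"
    (is "?L = ?R")
proof (intro equalityI subsetI)
  fix g assume "g \<in> ?L"
  then obtain A N where A: "proj A \<in> H" "block_diagonal b A" and N: "block_unipotent b N"
    and g: "g = proj (A ** N)"
    by (auto simp: set_mult_def mult_PGL)
  have "block_diagonal_part b (A ** N) = A"
    using N by (simp add: block_diagonal_part_mult_left[OF A(2)] block_unipotent_iff)
  moreover have "block_lower_triangular b (A ** N)"
    using A(2) N by (intro block_lower_triangular_mult block_diagonal_imp_lower block_unipotent_imp_lower)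
  ultimately show "g \<in> ?R" using g A(1) by auto
next
  fix g assume "g \<in> ?R"
  then obtain M where M: "block_lower_triangular b M" "proj (block_diagonal_part b M) \<in> H"
    and g: "g = proj M" by blast
  define A where "A = block_diagonal_part b M"
  have A: "invertible A" "block_diagonal b A" "block_diagonal b (matrix_inv A)"
    using M(2) assms proj_in_PGL_iff block_diagonal_block_diagonal_part block_diagonal_matrix_inv
    unfolding A_def by blast+
  define N where "N = matrix_inv A ** M"
  have "block_diagonal_part b N = mat 1"
    unfolding N_def block_diagonal_part_mult_left[OF A(3)] A_def[symmetric]
    using A(1) by (rule matrix_inv_cancel)
  moreover have "block_lower_triangular b N"
    unfolding N_def using block_diagonal_imp_lower[OF A(3)] M(1)
    by (rule block_lower_triangular_mult)
  ultimately have "block_unipotent b N" by (simp add: block_unipotent_iff)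
  moreover have "g = proj A \<otimes>\<^bsub>PGL\<^esub> proj N"
    using A(1) by (simp add: g mult_PGL N_def matrix_mul_assoc matrix_inv_cancel)
  ultimately show "g \<in> ?L"
    using A(2) M(2) by (auto simp: set_mult_def A_def)
qed

text \<open>The matrix \<open>B\<close> links an index \<open>i\<close> only to indices \<open>p\<close> with \<open>blk p = b i\<close>, and its inverse does so in the
  other direction; so selecting entries by a relation \<open>R\<close> between their blocks commutes with the change of
  basis. The cases of interest are equality, for the block diagonal part, and \<open>(<)\<close>, for the
  blocks above the diagonal.\<close>

lemma in_basis_block_entry:
  fixes B T :: "real^'n^'n"
  assumes "basis_respecting k E B blk" "\<And>i. i \<le> k \<Longrightarrow> E i = block_space b i"
  shows "(if R (b i) (b j) then in_basis B T $ i $ j else 0)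
    = in_basis B (\<chi> p q. if R (blk p) (blk q) then T $ p $ q else 0) $ i $ j"
proof -
  have B: "B $ i $ p = 0" if "b i \<noteq> blk p" for i p
  proof -
    have "column p B \<in> block_space b (blk p)"
      using assms by (auto simp: basis_respecting_def)
    then show ?thesis using that by (simp add: block_space_def column_def)
  qed
  have inv: "invertible B" using assms(1) by (simp add: basis_respecting_def)
  (* That B respects the blocks means that it intertwines the diagonal matrices of block numbers;
     in this form the property passes to the inverse. *)
  let ?Db = "diag_matrix (\<lambda>i. real (b i))" and ?Dblk = "diag_matrix (\<lambda>i. real (blk i))"
  have "B ** ?Dblk = ?Db ** B"
    unfolding vec_eq_iff matrix_mult_diag_nth diag_mult_matrix_nth
    by (metis B mult.commute mult_zero_left)
  then have "matrix_inv B ** (B ** ?Dblk) ** matrix_inv B = matrix_inv B ** (?Db ** B) ** matrix_inv B"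
    by simp
  moreover have "matrix_inv B ** (B ** ?Dblk) ** matrix_inv B = ?Dblk ** matrix_inv B"
    using inv by (simp add: matrix_mul_assoc matrix_inv_cancel)
  moreover have "matrix_inv B ** (?Db ** B) ** matrix_inv B = matrix_inv B ** ?Db"
    using inv by (simp add: matrix_inv_cancel flip: matrix_mul_assoc)
  ultimately have comm: "?Dblk ** matrix_inv B = matrix_inv B ** ?Db" by simp
  have inv_B: "matrix_inv B $ q $ j = 0" if "blk q \<noteq> b j" for q j
  proof -
    have "real (blk q) * matrix_inv B $ q $ j = matrix_inv B $ q $ j * real (b j)"
      using arg_cong[OF comm, of "\<lambda>M. M $ q $ j"]
      by (simp only: matrix_mult_diag_nth diag_mult_matrix_nth)
    then show ?thesis using that by simp
  qed
  have entry: "in_basis B S $ i $ j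
      = (\<Sum>q\<in>UNIV. (\<Sum>p\<in>UNIV. B $ i $ p * S $ p $ q) * matrix_inv B $ q $ j)" for S
    by (simp add: in_basis_def matrix_mult_nth)
  have masked: "(if R (b i) (b j) then B $ i $ p * T $ p $ q * matrix_inv B $ q $ j else 0)
      = B $ i $ p * (if R (blk p) (blk q) then T $ p $ q else 0) * matrix_inv B $ q $ j" for p q
    using B[of i p] inv_B[of q j] by (cases "b i = blk p"; cases "blk q = b j") auto
  have "in_basis B (\<chi> p q. if R (blk p) (blk q) then T $ p $ q else 0) $ i $ j
      = (\<Sum>q\<in>UNIV. \<Sum>p\<in>UNIV.
          if R (b i) (b j) then B $ i $ p * T $ p $ q * matrix_inv B $ q $ j else 0)"
    unfolding entry sum_distrib_right masked by simp
  then show ?thesis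
    by (cases "R (b i) (b j)") (simp_all add: entry sum_distrib_right)
qed

lemma in_basis_block_diagonal_part:
  assumes "basis_respecting k E B blk" "\<And>i. i \<le> k \<Longrightarrow> E i = block_space b i"
  shows "in_basis B (block_diagonal_part blk T) = block_diagonal_part b (in_basis B T)"
  using in_basis_block_entry[OF assms, where R = "(=)" and T = T]
  by (simp add: vec_eq_iff block_diagonal_part_def)

lemma in_basis_inverse:
  assumes "invertible B"
  shows "in_basis B (matrix_inv B ** M ** B) = M" "matrix_inv B ** in_basis B T ** B = T"
proof -
  have "in_basis B (matrix_inv B ** M ** B) = (B ** matrix_inv B) ** M ** (B ** matrix_inv B)"
    by (simp add: in_basis_def matrix_mul_assoc)
  then show "in_basis B (matrix_inv B ** M ** B) = M" by (simp add: matrix_inv_cancel[OF assms])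
  have "matrix_inv B ** in_basis B T ** B = (matrix_inv B ** B) ** T ** (matrix_inv B ** B)"
    by (simp add: in_basis_def matrix_mul_assoc)
  then show "matrix_inv B ** in_basis B T ** B = T" by (simp add: matrix_inv_cancel[OF assms])
qed

lemma in_basis_block_lower_triangular_iff:
  assumes "basis_respecting k E B blk" "\<And>i. i \<le> k \<Longrightarrow> E i = block_space b i"
  shows "block_lower_triangular blk T \<longleftrightarrow> block_lower_triangular b (in_basis B T)"
proof -
  have inv: "invertible B" using assms(1) by (simp add: basis_respecting_def)
  let ?U = "\<chi> p q. if blk p < blk q then T $ p $ q else 0"
  have "block_lower_triangular blk T \<longleftrightarrow> ?U = 0"
    by (auto simp: block_lower_triangular_def vec_eq_iff)
  also have "\<dots> \<longleftrightarrow> in_basis B ?U = 0"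
  proof
    assume "in_basis B ?U = 0"
    then show "?U = 0"
      using in_basis_inverse(2)[OF inv, of ?U] by (simp add: vec_eq_iff matrix_mult_nth)
  qed (simp add: in_basis_def vec_eq_iff matrix_mult_nth)
  also have "\<dots> \<longleftrightarrow> block_lower_triangular b (in_basis B T)"
  proof -
    have entry: "in_basis B ?U $ i $ j = (if b i < b j then in_basis B T $ i $ j else 0)" for i j
      using in_basis_block_entry[OF assms, where R = "(<)" and T = T] by (rule sym)
    show ?thesis by (simp add: vec_eq_iff[of "in_basis B ?U"] vec_eq_iff[of "in_basis B ?U $ _"]
        entry block_lower_triangular_def)
  qed
  finally show ?thesis .
qed

text \<open>Every diagonal entry is the eigenvalue of a basis vector, hence some \<open>ev j\<close>, and \<open>b\<close>
  picks its number. Strict monotonicity of \<open>ev\<close> makes the order of the block numbers that of the entries.\<close>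

lemma diagonal_matrix_eigenspaces:
  fixes X :: "real^'n^'n"
  assumes X: "X \<in> diagonal_matrices"
    and ev: "strict_mono_on {..k} ev" "ev ` {..k} = eigenvalues X"
  obtains d b where "X = diag_matrix d" "\<And>i. b i \<le> k" "\<And>i j. d i < d j \<longleftrightarrow> b i < b j"
    "\<And>j. j \<le> k \<Longrightarrow> eigenspace X (ev j) = block_space b j"
proof -
  define d where "d i = X $ i $ i" for i
  have X_eq: "X = diag_matrix d" using X by (auto simp: vec_eq_iff diagonal_matrices_def d_def)
  have mult: "(X *v v) $ i = d i * v $ i" for v i
    by (simp add: X_eq matrix_vector_nth if_distrib[of "\<lambda>x. x * _"] cong: if_cong)
  have "X *v axis i 1 = d i *\<^sub>R axis i 1" for i
    by (simp add: vec_eq_iff mult) (simp add: axis_def)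
  moreover have "axis i 1 \<noteq> (0 :: real^'n)" for i by simp
  ultimately have "d i \<in> eigenvalues X" for i unfolding eigenvalues_def by blast
  then have "d i \<in> ev ` {..k}" for i by (simp add: ev(2))
  then have "\<exists>j\<le>k. ev j = d i" for i by (metis atMost_iff imageE)
  then obtain b where b: "\<And>i. b i \<le> k" "\<And>i. ev (b i) = d i" by metis
  have ev_less: "ev i < ev j \<longleftrightarrow> i < j" if "i \<le> k" "j \<le> k" for i j
    using strict_mono_on_less[OF ev(1)] that by simp
  have ev_eq: "ev i = ev j \<longleftrightarrow> i = j" if "i \<le> k" "j \<le> k" for i j
    using strict_mono_on_eq[OF ev(1)] that by simp
  show ?thesis
  proof (rule that[OF X_eq b(1)])
    show "d i < d j \<longleftrightarrow> b i < b j" for i j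
      using ev_less[OF b(1) b(1), of i j] by (simp add: b(2))
    show "eigenspace X (ev j) = block_space b j" if "j \<le> k" for j
    proof -
      have "d i = ev j \<longleftrightarrow> b i = j" for i using ev_eq[OF b(1) that, of i] by (simp add: b(2))
      then show ?thesis by (auto simp: eigenspace_def block_space_def vec_eq_iff mult)
    qed
  qed
qed

theorem corollary4p8:
  fixes \<sigma> :: "(real^'n^'n) set \<Rightarrow> (real^'n^'n) set"
    and H L :: "(real^'n^'n) set set"
    and \<bb> :: "(real^'n^'n) set"
    and X :: "real^'n^'n"
    and k :: nat and ev :: "nat \<Rightarrow> real" and E V :: "nat \<Rightarrow> (real^'n) set"
  assumes "symmetric_subgroup \<sigma> H"
    and "\<forall>g\<in>carrier PGL. \<sigma> (cartan_involution g) = cartan_involution (\<sigma> g)"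
    and "maximal_abelian_subalgebra_of
           (minus_eigenspace cartan_involution \<inter> minus_eigenspace \<sigma>) \<bb>"
    and "\<bb> \<subseteq> diagonal_matrices \<inter> traceless"
    and "X \<in> \<bb>"
    and "L = centralizer_in H X <#>\<^bsub>PGL\<^esub> N_plus X"
    and "limitin (chabauty_topology PGL PGL_topology) (conjugate_subgroup X H) L at_top"
    and "strict_mono_on {..k} ev" and "ev ` {..k} = eigenvalues X"
    and "\<And>i. i \<le> k \<Longrightarrow> E i = eigenspace X (ev i)"
    and "\<And>j. j \<le> k + 1 \<Longrightarrow> V j = span (\<Union>i\<in>{j..k}. E i)"
  shows "L \<subseteq> PGL_flag k V \<and>
    centralizer_in H X = {h \<in> H. \<forall>A\<in>h. \<forall>i\<le>k. (*v) A ` E i = E i} \<and>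
    N_plus X = flag_unipotent k V \<and>
    (\<forall>B blk. basis_respecting k E B blk \<longrightarrow>
       L = {proj (in_basis B T) | T. block_lower_triangular blk T \<and>
              proj (in_basis B (block_diagonal_part blk T)) \<in> H \<inter> P_GL_sum k E})"
proof -
  have H: "H \<subseteq> carrier PGL" using assms(1) by (auto simp: symmetric_subgroup_def dest: subgroup.subset)
  have "X \<in> diagonal_matrices" using assms(4,5) by blast
  then obtain d b where X: "X = diag_matrix d" and b: "\<And>i. b i \<le> k"
    and ord: "\<And>i j. d i < d j \<longleftrightarrow> b i < b j"
    and eigen: "\<And>j. j \<le> k \<Longrightarrow> eigenspace X (ev j) = block_space b j"
    using diagonal_matrix_eigenspaces[OF _ assms(8,9)] by blast
  have E: "E i = block_space b i" if "i \<le> k" for i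
    using that assms(10) eigen by simp
  have V: "V j = flag_space b j" if "j \<le> k + 1" for j
    using assms(11)[OF that] E span_block_spaces[of b k j, OF b] by simp
  have "d i = d j \<longleftrightarrow> b i = b j" for i j
    using ord[of i j] ord[of j i] by linarith
  then have Z: "centralizer_in H X = {proj A | A. proj A \<in> H \<and> block_diagonal b A}"
    unfolding X by (rule centralizer_in_diag[OF H])
  have N: "N_plus X = {proj N | N. block_unipotent b N}"
    unfolding X using ord by (rule N_plus_diag)
  have L: "L = {proj M | M. block_lower_triangular b M \<and> proj (block_diagonal_part b M) \<in> H}"
    unfolding assms(6) Z N by (rule block_diagonal_times_unipotent[OF H])
  note sum_iff = P_GL_sum_block_iff[of b k E, OF b E] and flag_iff = PGL_flag_block_iff[of b k V, OF b V]
  show ?thesis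
  proof (intro conjI allI impI)
    show "L \<subseteq> PGL_flag k V"
    proof
      fix g assume "g \<in> L"
      then obtain M where M: "g = proj M" "block_lower_triangular b M" using L by blast
      have "g \<in> carrier PGL"
        using \<open>g \<in> L\<close> H unfolding assms(6) N_plus_def centralizer_in_def set_mult_def
        by (auto intro: monoid.m_closed[OF group.is_monoid[OF group_PGL]])
      then show "g \<in> PGL_flag k V" using M by (simp add: flag_iff proj_in_PGL_iff)
    qed
    have "h \<in> centralizer_in H X \<longleftrightarrow> h \<in> H \<inter> P_GL_sum k E" for h
    proof -
      have "h \<in> centralizer_in H X \<longleftrightarrow> (\<exists>A. h = proj A \<and> h \<in> H \<and> invertible A \<and> block_diagonal b A)"
        unfolding Z using H proj_in_PGL_iff by blast
      also have "\<dots> \<longleftrightarrow> h \<in> H \<inter> P_GL_sum k E"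
        using H sum_iff by (auto simp: carrier_PGL)
      finally show ?thesis .
    qed
    then show "centralizer_in H X = {h \<in> H. \<forall>A\<in>h. \<forall>i\<le>k. (*v) A ` E i = E i}"
      using H unfolding P_GL_sum_def by blast
    show "N_plus X = flag_unipotent k V"
      unfolding N using flag_unipotent_eq[of b k V, OF b V] by simp
  next
    fix B blk assume B: "basis_respecting k E B blk"
    (* A block diagonal element of H preserves the eigenspaces automatically. *)
    have "proj (block_diagonal_part b M) \<in> H \<longleftrightarrow> proj (block_diagonal_part b M) \<in> H \<inter> P_GL_sum k E" for M
      using H proj_in_PGL_iff by (auto simp: sum_iff block_diagonal_block_diagonal_part)
    then have "L = {proj M | M. block_lower_triangular b M \<and>
        proj (block_diagonal_part b M) \<in> H \<inter> P_GL_sum k E}"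
      unfolding L by blast
    also have "\<dots> = {proj (in_basis B T) | T. block_lower_triangular b (in_basis B T) \<and>
        proj (block_diagonal_part b (in_basis B T)) \<in> H \<inter> P_GL_sum k E}"
    proof (intro equalityI subsetI)
      fix g assume "g \<in> {proj M | M. block_lower_triangular b M \<and>
        proj (block_diagonal_part b M) \<in> H \<inter> P_GL_sum k E}"
      then obtain M where M: "g = proj M" "block_lower_triangular b M"
        "proj (block_diagonal_part b M) \<in> H \<inter> P_GL_sum k E" by blast
      have "in_basis B (matrix_inv B ** M ** B) = M"
        using B by (simp add: in_basis_inverse(1) basis_respecting_def)
      then obtain T where "M = in_basis B T" by metis
      with M show "g \<in> {proj (in_basis B T) | T. block_lower_triangular b (in_basis B T) \<and>
        proj (block_diagonal_part b (in_basis B T)) \<in> H \<inter> P_GL_sum k E}" by blast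
    qed blast
    also have "\<dots> = {proj (in_basis B T) | T. block_lower_triangular blk T \<and>
        proj (in_basis B (block_diagonal_part blk T)) \<in> H \<inter> P_GL_sum k E}"
      by (simp only: in_basis_block_diagonal_part[OF B E] in_basis_block_lower_triangular_iff[OF B E])
    finally show "L = {proj (in_basis B T) | T. block_lower_triangular blk T \<and>
        proj (in_basis B (block_diagonal_part blk T)) \<in> H \<inter> P_GL_sum k E}" .
  qed
qed

end
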